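(* Let $K\in\mathbb{N}$ and let $G=(Q,\Sigma,\delta,I)$ be a discrete-event system with a single observable event, $\Sigma_o=\{a\}$, with secret states $Q_S\subseteq Q$, non-secret states $Q_{NS}=Q\setminus Q_S$, and projection $P\colon\Sigma^*\to\{a\}^*$. Define $Q_S'$ and $Q_{NS}'$ as follows. (i) If $P(L(G))$ is finite and $G$ is $K$-step opaque with respect to $Q_S,Q_{NS},P$, then $Q_S'=Q_S$ and $Q_{NS}'=Q_{NS}$. (ii) If $P(L(G))$ is finite and $G$ is not $K$-step opaque with respect to $Q_S,Q_{NS},P$, then $Q_{NS}'=\emptyset$ and $Q_S'=Q$. (iii) If $P(L(G))$ is infinite, then $Q_{NS}'=\{q\in Q_{NS}\mid\varphi(q)=K\}$ and $Q_S'=Q\setminus Q_{NS}'$, where $\varphi\colon Q\to\{0,\ldots,K\}$ is given by $\varphi(q)=\max\{k\in\{0,\ldots,K\}\mid\delta(q,P^{-1}(a^k))\neq\emptyset\}$. Then $G$ is $K$-step opaque with respect to $Q_S$, $Q_{NS}$, and $P$ if and only if $G$ is current-state opaque with respect to $Q_S'$, $Q_{NS}'$, and $P$.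
   Context: An NFA over a finite nonempty alphabet $\Sigma$ is $(Q,\Sigma,\delta,I)$ with finite state set $Q$, initial states $I\subseteq Q$, and $\delta\colon Q\times\Sigma\to 2^Q$, extended in the usual way to $2^Q\times\Sigma^*$; for $S\subseteq\Sigma^*$, $\delta(X,S)=\bigcup_{s\in S}\delta(X,s)$. $L(G)=\{w\mid\delta(I,w)\ne\emptyset\}$. A discrete-event system (DES) is an NFA together with a partition of $\Sigma$ into observable events $\Sigma_o$ and unobservable events $\Sigma_{uo}$. The projection $P\colon\Sigma^*\to\Sigma_o^*$ is the morphism erasing the unobservable events. $K$-step opacity: $G$ is $K$-step opaque w.r.t. secret states $Q_S$, non-secret states $Q_{NS}$, and $P$ if for every $st\in L(G)$ with $|P(t)|\le K$ and $\delta(\delta(I,s)\cap Q_S,t)\neq\emptyset$, there is $s't'\in L(G)$ such that $P(s)=P(s')$, $P(t)=P(t')$, and $\delta(\delta(I,s')\cap Q_{NS},t')\neq\emptyset$. Current-state opacity is $0$-step opacity. *)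

theory Defs
  imports Main
begin

record ('q, 'e) nfa =
  states :: "'q set"
  alphabet :: "'e set"
  trans_fun :: "'q \<Rightarrow> 'e \<Rightarrow> 'q set"
  initial :: "'q set"

definition is_nfa :: "('q, 'e, 'more) nfa_scheme \<Rightarrow> bool" where
  "is_nfa G \<longleftrightarrow>
     finite (states G) \<and> finite (alphabet G) \<and> alphabet G \<noteq> {} \<and>
     initial G \<subseteq> states G \<and>
     (\<forall>q \<in> states G. \<forall>e \<in> alphabet G. trans_fun G q e \<subseteq> states G)"

primrec delta :: "('q, 'e, 'more) nfa_scheme \<Rightarrow> 'q set \<Rightarrow> 'e list \<Rightarrow> 'q set" where
  "delta G X [] = X"
| "delta G X (e # w) = delta G (\<Union>q\<in>X. trans_fun G q e) w"

definition delta_lang ::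
    "('q, 'e, 'more) nfa_scheme \<Rightarrow> 'q set \<Rightarrow> 'e list set \<Rightarrow> 'q set" where
  "delta_lang G X S = (\<Union>s\<in>S. delta G X s)"

definition lang :: "('q, 'e, 'more) nfa_scheme \<Rightarrow> 'e list set" where
  "lang G = {w \<in> lists (alphabet G). delta G (initial G) w \<noteq> {}}"

record ('q, 'e) des = "('q, 'e) nfa" +
  observable :: "'e set"
  unobservable :: "'e set"

text \<open>Either part of the partition of the alphabet is allowed to be empty.\<close>

definition is_des :: "('q, 'e, 'more) des_scheme \<Rightarrow> bool" where
  "is_des G \<longleftrightarrow>
     is_nfa G \<and>
     observable G \<union> unobservable G = alphabet G \<and>
     observable G \<inter> unobservable G = {}"

text \<open>On words over the alphabet this is the morphism erasing the unobservable events.\<close>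

definition proj :: "('q, 'e, 'more) des_scheme \<Rightarrow> 'e list \<Rightarrow> 'e list" where
  "proj G w = filter (\<lambda>e. e \<in> observable G) w"

definition k_step_opaque ::
    "nat \<Rightarrow> ('q, 'e, 'more) des_scheme \<Rightarrow> 'q set \<Rightarrow> 'q set \<Rightarrow> ('e list \<Rightarrow> 'e list) \<Rightarrow> bool" where
  "k_step_opaque K G Q\<^sub>S Q\<^sub>N\<^sub>S P \<longleftrightarrow>
     (\<forall>s t. s @ t \<in> lang G \<and> length (P t) \<le> K \<and>
            delta G (delta G (initial G) s \<inter> Q\<^sub>S) t \<noteq> {} \<longrightarrow>
        (\<exists>s' t'. s' @ t' \<in> lang G \<and> P s = P s' \<and> P t = P t' \<and>
                 delta G (delta G (initial G) s' \<inter> Q\<^sub>N\<^sub>S) t' \<noteq> {}))"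

definition current_state_opaque ::
    "('q, 'e, 'more) des_scheme \<Rightarrow> 'q set \<Rightarrow> 'q set \<Rightarrow> ('e list \<Rightarrow> 'e list) \<Rightarrow> bool" where
  "current_state_opaque = k_step_opaque 0"

text \<open>
  When \<open>P\<close> is the projection, the empty word puts \<open>0\<close> into the set, so the set is finite and
  nonempty and \<open>Max\<close> is well-defined.
\<close>

definition phi ::
    "nat \<Rightarrow> ('q, 'e, 'more) des_scheme \<Rightarrow> ('e list \<Rightarrow> 'e list) \<Rightarrow> 'e \<Rightarrow> 'q \<Rightarrow> nat" where
  "phi K G P a q =
     Max {k \<in> {0..K}.
       delta_lang G {q} {w \<in> lists (alphabet G). P w = replicate k a} \<noteq> {}}"

end

theory Submission
  imports Defs
begin

text \<open>
  Over a single observable event, an infinite projected language is all of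
  \<open>a\<^sup>*\<close>. Both opacity notions then say the same thing: for every \<open>n\<close>, some word with
  projection \<open>a\<^sup>n\<close> reaches a non-secret state that can still observe \<open>K\<close> further events.
  Such a state witnesses every shorter continuation as well, since a run can be cut off at
  any number of observations. In the finite case the construction depends on whether \<open>G\<close> is
  \<open>K\<close>-step opaque, so that \<open>K\<close>-step opacity implies current-state opacity, while its failure
  forces a nonempty language without any non-secret state to hide it.
\<close>

section \<open>Runs and prefixes\<close>

lemma delta_append: "delta G X (u @ v) = delta G (delta G X u) v"
  by (induction u arbitrary: X) auto

lemma delta_eq_UN: "delta G X w = (\<Union>q\<in>X. delta G {q} w)"
proof (induction w arbitrary: X)
  case (Cons e w)
  have "delta G X (e # w) = (\<Union>p\<in>(\<Union>q\<in>X. trans_fun G q e). delta G {p} w)"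
    using Cons.IH[of "\<Union>q\<in>X. trans_fun G q e"] by simp
  also have "\<dots> = (\<Union>q\<in>X. \<Union>p\<in>trans_fun G q e. delta G {p} w)"
    by blast
  also have "\<dots> = (\<Union>q\<in>X. delta G {q} (e # w))"
    by (intro SUP_cong refl) (simp add: Cons.IH[symmetric])
  finally show ?case .
qed simp

lemma delta_empty [simp]: "delta G {} w = {}"
  by (subst delta_eq_UN) simp

lemma delta_nonempty_iff: "delta G X w \<noteq> {} \<longleftrightarrow> (\<exists>q\<in>X. delta G {q} w \<noteq> {})"
  by (subst delta_eq_UN) simp

text \<open>Ensures that a reached state outside a set \<open>N\<close> lies in
  \<open>states G - N\<close>, so that every reached state is either secret or non-secret.\<close>

lemma delta_subset_states:
  assumes "is_nfa G" "w \<in> lists (alphabet G)" "X \<subseteq> states G"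
  shows "delta G X w \<subseteq> states G"
  using assms(2,3)
proof (induction w arbitrary: X)
  case (Cons e w)
  have "(\<Union>q\<in>X. trans_fun G q e) \<subseteq> states G"
    using Cons.hyps Cons.prems assms(1) unfolding is_nfa_def by blast
  then show ?case using Cons.IH by simp
qed simp

lemma lang_appendD: "s @ t \<in> lang G \<Longrightarrow> s \<in> lang G"
  by (auto simp: lang_def delta_append)

lemma lang_appendI:
  assumes "s \<in> lang G" "q \<in> delta G (initial G) s"
    and "t \<in> lists (alphabet G)" "delta G {q} t \<noteq> {}"
  shows "s @ t \<in> lang G"
  using assms delta_nonempty_iff[of G "delta G (initial G) s" t]
  by (auto simp: lang_def delta_append)

section \<open>Projection to a single observable event\<close>

lemma proj_Nil [simp]: "proj G [] = []"
  by (simp add: proj_def)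

lemma proj_append [simp]: "proj G (u @ v) = proj G u @ proj G v"
  by (simp add: proj_def)

text \<open>Equality of projections can hence be checked by counting observations.\<close>

lemma proj_single:
  assumes "observable G = {a}"
  shows "proj G w = replicate (length (proj G w)) a"
  using assms by (induction w) (auto simp: proj_def)

text \<open>Each letter adds at most one observation, so no count is skipped along the prefixes of
  \<open>w\<close>.\<close>

lemma proj_split:
  "m \<le> length (proj G w) \<Longrightarrow> \<exists>u v. w = u @ v \<and> length (proj G u) = m"
proof (induction w arbitrary: m)
  case (Cons e w)
  show ?case
  proof (cases m)
    case 0
    then show ?thesis by (intro exI[of _ "[]"] exI[of _ "e # w"]) simp
  next
    case (Suc n)
    \<comment> \<open>The number of observations still to be collected from the tail: an observable
      \<open>e\<close> already accounts for one of the \<open>m\<close>.\<close>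
    define i where "i = (if e \<in> observable G then n else m)"
    have "i \<le> length (proj G w)"
      using Cons.prems Suc by (auto simp: i_def proj_def split: if_splits)
    then obtain u v where "w = u @ v" "length (proj G u) = i"
      using Cons.IH by blast
    then show ?thesis
      using Suc
      by (intro exI[of _ "e # u"] exI[of _ v]) (auto simp: i_def proj_def)
  qed
qed (auto simp: proj_def)

text \<open>A bound on the number of observations would leave only finitely many powers of
  \<open>a\<close> as projections.\<close>

lemma lang_proj_unbounded:
  assumes "observable G = {a}" "infinite (proj G ` lang G)"
  obtains w where "w \<in> lang G" "n \<le> length (proj G w)"
proof (rule ccontr)
  assume "\<not> thesis"
  with that have "\<forall>w\<in>lang G. length (proj G w) < n"
    by (meson not_le)
  then have "proj G ` lang G \<subseteq> (\<lambda>k. replicate k a) ` {..<n}"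
    using proj_single[OF assms(1)] by blast
  then show False
    using assms(2) finite_subset by blast
qed

text \<open>The maximum ranges over a subset of \<open>{0..K}\<close>, so it equals its upper bound
  \<open>K\<close> exactly when \<open>K\<close> is a member.\<close>

lemma phi_eq_K_iff:
  "phi K G (proj G) a q = K \<longleftrightarrow>
     (\<exists>w\<in>lists (alphabet G). proj G w = replicate K a \<and> delta G {q} w \<noteq> {})"
proof -
  define A where "A = {k \<in> {0..K}.
    delta_lang G {q} {w \<in> lists (alphabet G). proj G w = replicate k a} \<noteq> {}}"
  have fin: "finite A" by (simp add: A_def)
  \<comment> \<open>The empty word makes \<open>A\<close> nonempty, without which
    \<open>Max A\<close> would be an unspecified value.\<close>
  have "0 \<in> A"
    by (auto simp: A_def delta_lang_def intro!: exI[of _ "[]"])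
  then have "Max A \<in> A" using fin Max_in by blast
  moreover have "Max A = K" if "K \<in> A"
  proof (rule Max_eqI[OF fin _ that])
    show "y \<le> K" if "y \<in> A" for y using that by (simp add: A_def)
  qed
  ultimately have "Max A = K \<longleftrightarrow> K \<in> A" by metis
  then show ?thesis
    unfolding phi_def A_def[symmetric] by (auto simp: A_def delta_lang_def)
qed

section \<open>Witnesses supplied by opacity\<close>

lemma k_step_opaque_mono:
  "k_step_opaque K G S N P \<Longrightarrow> J \<le> K \<Longrightarrow> k_step_opaque J G S N P"
  unfolding k_step_opaque_def using order_trans by blast

text \<open>Speaks of single states \<open>q\<close> and \<open>q'\<close> in place of nonempty
  state sets, so that later arguments can follow individual runs.\<close>

lemma k_step_opaqueE:
  assumes "k_step_opaque K G S N P" "s @ t \<in> lang G" "length (P t) \<le> K"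
    and "q \<in> delta G (initial G) s" "q \<in> S" "delta G {q} t \<noteq> {}"
  obtains s' t' q' where "s' @ t' \<in> lang G" "P s' = P s" "P t' = P t"
    "q' \<in> delta G (initial G) s'" "q' \<in> N" "delta G {q'} t' \<noteq> {}"
proof -
  have "delta G (delta G (initial G) s \<inter> S) t \<noteq> {}"
    unfolding delta_nonempty_iff[of G "delta G (initial G) s \<inter> S"] using assms(4-6) by blast
  then have "\<exists>s' t'. s' @ t' \<in> lang G \<and> P s = P s' \<and> P t = P t' \<and>
      delta G (delta G (initial G) s' \<inter> N) t' \<noteq> {}"
    using assms(1-3) unfolding k_step_opaque_def by blast
  then obtain s' t' where st: "s' @ t' \<in> lang G" "P s' = P s" "P t' = P t"
    and ne: "delta G (delta G (initial G) s' \<inter> N) t' \<noteq> {}"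
    by metis
  from ne obtain q' where "q' \<in> delta G (initial G) s' \<inter> N" "delta G {q'} t' \<noteq> {}"
    unfolding delta_nonempty_iff[of G "delta G (initial G) s' \<inter> N"] by blast
  then show thesis using that st by blast
qed

text \<open>Take any state reached by \<open>s\<close>. If it lies in \<open>N\<close>, then
  \<open>s\<close> itself serves; otherwise the state is secret, and opacity with an empty
  continuation yields the witness.\<close>

lemma current_state_opaque_witness:
  assumes "is_nfa G" "s \<in> lang G"
    and "current_state_opaque G (states G - N) N (proj G)"
  obtains s' q where "s' \<in> lang G" "proj G s' = proj G s"
    "q \<in> delta G (initial G) s'" "q \<in> N"
proof -
  obtain p where p: "p \<in> delta G (initial G) s"
    using assms(2) by (auto simp: lang_def)
  have "p \<in> states G"
    using p assms(1,2) delta_subset_states[of G s "initial G"]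
    by (auto simp: lang_def is_nfa_def)
  show thesis
  proof (cases "p \<in> N")
    case True
    then show thesis using that assms(2) p by blast
  next
    case False
    have "s @ [] \<in> lang G" using assms(2) by simp
    then obtain s' t' q where "s' @ t' \<in> lang G" "proj G s' = proj G s"
      "q \<in> delta G (initial G) s'" "q \<in> N"
      by (rule k_step_opaqueE[OF assms(3)[unfolded current_state_opaque_def], of s "[]" p])
        (use p \<open>p \<in> states G\<close> False in simp_all)
    then show thesis using that lang_appendD by blast
  qed
qed

text \<open>Cut a long word after \<open>n\<close> and after \<open>n + K\<close> observations. The
  state between the two pieces can still observe \<open>K\<close> events; if it is secret, opacity
  exchanges it for a non-secret state with the same ability.\<close>

lemma k_step_opaque_witness:
  assumes "is_nfa G" "observable G = {a}" "infinite (proj G ` lang G)"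
    and "k_step_opaque K G S (states G - S) (proj G)"
  obtains s q where "s \<in> lang G" "proj G s = replicate n a"
    "q \<in> delta G (initial G) s" "q \<in> states G - S" "phi K G (proj G) a q = K"
proof -
  obtain w where "w \<in> lang G" "n + K \<le> length (proj G w)"
    by (rule lang_proj_unbounded[OF assms(2,3)])
  \<comment> \<open>The surplus \<open>z\<close> is dropped to leave exactly \<open>K\<close>
    observations in \<open>t\<close>: more would exceed the bound in the definition of opacity,
    fewer would not give \<open>phi\<close> the value \<open>K\<close>.\<close>
  then obtain x z where w_eq: "w = x @ z" and "length (proj G x) = n + K"
    using proj_split by blast
  moreover obtain s t where "x = s @ t" "length (proj G s) = n"
    using proj_split[of n G x] \<open>length (proj G x) = n + K\<close> by auto
  ultimately have st: "x = s @ t" "length (proj G s) = n" "length (proj G t) = K"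
    by simp_all
  have L: "s @ t \<in> lang G"
    using \<open>w \<in> lang G\<close> w_eq st(1) lang_appendD by metis
  have P: "proj G s = replicate n a" "proj G t = replicate K a"
    by (subst proj_single[OF assms(2)], simp only: st)+
  have "delta G (delta G (initial G) s) t \<noteq> {}"
    using L by (simp add: lang_def delta_append)
  then obtain p where p: "p \<in> delta G (initial G) s" "delta G {p} t \<noteq> {}"
    unfolding delta_nonempty_iff[of G "delta G (initial G) s" t] by blast
  have "p \<in> states G"
    using p(1) L assms(1) delta_subset_states[of G s "initial G"]
    by (auto simp: lang_def is_nfa_def)
  have "\<exists>s' t' q. s' @ t' \<in> lang G \<and> proj G s' = replicate n a \<and> proj G t' = replicate K a \<and>
    q \<in> delta G (initial G) s' \<and> q \<in> states G - S \<and> delta G {q} t' \<noteq> {}"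
  proof (cases "p \<in> S")
    case True
    have "length (proj G t) \<le> K" using st(3) by simp
    then obtain s' t' q where "s' @ t' \<in> lang G" "proj G s' = proj G s"
      "proj G t' = proj G t" "q \<in> delta G (initial G) s'" "q \<in> states G - S"
      "delta G {q} t' \<noteq> {}"
      by (rule k_step_opaqueE[OF assms(4) L _ p(1) True p(2)])
    then show ?thesis using P by metis
  next
    case False
    then show ?thesis using L P p \<open>p \<in> states G\<close> by blast
  qed
  then obtain s' t' q where *: "s' @ t' \<in> lang G" "proj G s' = replicate n a"
    "proj G t' = replicate K a" "q \<in> delta G (initial G) s'" "q \<in> states G - S"
    "delta G {q} t' \<noteq> {}"
    by blast
  have "phi K G (proj G) a q = K"
    using * by (auto simp: phi_eq_K_iff lang_def)
  then show thesis using that * lang_appendD by blast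
qed

section \<open>The infinite case, then the finite ones\<close>

lemma k_step_opaque_iff_current_state_opaque:
  assumes "is_nfa G" "observable G = {a}" "infinite (proj G ` lang G)"
    and N': "N' = {q \<in> states G - S. phi K G (proj G) a q = K}"
  shows "k_step_opaque K G S (states G - S) (proj G) \<longleftrightarrow>
    current_state_opaque G (states G - N') N' (proj G)"
proof
  assume opaque: "k_step_opaque K G S (states G - S) (proj G)"
  show "current_state_opaque G (states G - N') N' (proj G)"
    unfolding current_state_opaque_def k_step_opaque_def
  proof (intro allI impI)
    fix s t
    assume "s @ t \<in> lang G \<and> length (proj G t) \<le> 0 \<and>
      delta G (delta G (initial G) s \<inter> (states G - N')) t \<noteq> {}"
    then have "proj G t = []" by simp
    \<comment> \<open>The witness is taken for as many observations as \<open>s\<close> has. Since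
      \<open>t\<close> is unobservable, it can be matched by the empty word.\<close>
    moreover obtain s' q where "s' \<in> lang G" "proj G s' = replicate (length (proj G s)) a"
      "q \<in> delta G (initial G) s'" "q \<in> N'"
      using k_step_opaque_witness[OF assms(1-3) opaque] unfolding N' by blast
    moreover have "proj G s = replicate (length (proj G s)) a"
      by (rule proj_single[OF assms(2)])
    ultimately show "\<exists>s' t'. s' @ t' \<in> lang G \<and> proj G s = proj G s' \<and> proj G t = proj G t' \<and>
        delta G (delta G (initial G) s' \<inter> N') t' \<noteq> {}"
      by (intro exI[of _ s'] exI[of _ "[]"]) auto
  qed
next
  assume opaque: "current_state_opaque G (states G - N') N' (proj G)"
  show "k_step_opaque K G S (states G - S) (proj G)"
    unfolding k_step_opaque_def
  proof (intro allI impI)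
    fix s t
    assume st: "s @ t \<in> lang G \<and> length (proj G t) \<le> K \<and>
      delta G (delta G (initial G) s \<inter> S) t \<noteq> {}"
    then obtain s' q where s': "s' \<in> lang G" "proj G s' = proj G s"
      "q \<in> delta G (initial G) s'" "q \<in> N'"
      using current_state_opaque_witness[OF assms(1) _ opaque] lang_appendD by metis
    then obtain w where w: "w \<in> lists (alphabet G)" "proj G w = replicate K a"
      "delta G {q} w \<noteq> {}"
      by (auto simp: N' phi_eq_K_iff)
    \<comment> \<open>The run from \<open>q\<close> on \<open>w\<close> has \<open>K\<close>
      observations, at least as many as \<open>t\<close>, so it can be cut to match
      \<open>t\<close>; the rest \<open>v\<close> is discarded.\<close>
    then obtain t' v where t': "w = t' @ v" "length (proj G t') = length (proj G t)"
      using st proj_split[of "length (proj G t)" G w] by auto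
    have "proj G t' = proj G t"
      by (subst (1 2) proj_single[OF assms(2)]) (simp only: t'(2))
    moreover have ne: "delta G {q} t' \<noteq> {}"
      using w(3) t'(1) by (auto simp: delta_append)
    moreover have "s' @ t' \<in> lang G"
      using w(1) t'(1) by (intro lang_appendI[OF s'(1,3) _ ne]) simp
    moreover have "delta G (delta G (initial G) s' \<inter> (states G - S)) t' \<noteq> {}"
      unfolding delta_nonempty_iff[of G "delta G (initial G) s' \<inter> (states G - S)"]
      using s'(3,4) ne by (auto simp: N')
    ultimately show "\<exists>s' t'. s' @ t' \<in> lang G \<and> proj G s = proj G s' \<and> proj G t = proj G t' \<and>
        delta G (delta G (initial G) s' \<inter> (states G - S)) t' \<noteq> {}"
      using s'(2) by (intro exI[of _ s'] exI[of _ t']) simp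
  qed
qed

lemma not_current_state_opaque_no_nonsecret:
  assumes "is_nfa G" "s \<in> lang G"
  shows "\<not> current_state_opaque G (states G) {} (proj G)"
  using current_state_opaque_witness[of G s "{}"] assms by auto

theorem theorem11:
  fixes K :: nat
    and G :: "('q, 'e) des"
    and a :: 'e
    and Q\<^sub>S Q\<^sub>N\<^sub>S Q\<^sub>S' Q\<^sub>N\<^sub>S' :: "'q set"
    and P :: "'e list \<Rightarrow> 'e list"
  assumes "is_des G"
    and "observable G = {a}"
    and "Q\<^sub>S \<subseteq> states G"
    and "Q\<^sub>N\<^sub>S = states G - Q\<^sub>S"
    and "P = proj G"
    and "finite (P ` lang G) \<and> k_step_opaque K G Q\<^sub>S Q\<^sub>N\<^sub>S P \<longrightarrow>
           Q\<^sub>S' = Q\<^sub>S \<and> Q\<^sub>N\<^sub>S' = Q\<^sub>N\<^sub>S"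
    and "finite (P ` lang G) \<and> \<not> k_step_opaque K G Q\<^sub>S Q\<^sub>N\<^sub>S P \<longrightarrow>
           Q\<^sub>N\<^sub>S' = {} \<and> Q\<^sub>S' = states G"
    and "infinite (P ` lang G) \<longrightarrow>
           Q\<^sub>N\<^sub>S' = {q \<in> Q\<^sub>N\<^sub>S. phi K G P a q = K} \<and> Q\<^sub>S' = states G - Q\<^sub>N\<^sub>S'"
  shows "k_step_opaque K G Q\<^sub>S Q\<^sub>N\<^sub>S P \<longleftrightarrow> current_state_opaque G Q\<^sub>S' Q\<^sub>N\<^sub>S' P"
proof -
  have nfa: "is_nfa G" using assms(1) by (simp add: is_des_def)
  consider (fin_opaque) "finite (P ` lang G)" "k_step_opaque K G Q\<^sub>S Q\<^sub>N\<^sub>S P"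
    | (fin_not_opaque) "finite (P ` lang G)" "\<not> k_step_opaque K G Q\<^sub>S Q\<^sub>N\<^sub>S P"
    | (inf) "infinite (P ` lang G)"
    by blast
  then show ?thesis
  proof cases
    case fin_opaque
    then show ?thesis
      using assms(6) k_step_opaque_mono[of K G Q\<^sub>S Q\<^sub>N\<^sub>S P 0]
      by (simp add: current_state_opaque_def)
  next
    case fin_not_opaque
    \<comment> \<open>An empty language would be vacuously opaque, so the failure of opacity yields
      a word.\<close>
    then obtain s t where "s @ t \<in> lang G"
      unfolding k_step_opaque_def by blast
    then show ?thesis
      using fin_not_opaque assms(5,7) not_current_state_opaque_no_nonsecret[OF nfa]
      by (auto dest: lang_appendD)
  next
    case inf
    then show ?thesis
      using k_step_opaque_iff_current_state_opaque[OF nfa assms(2), of Q\<^sub>N\<^sub>S' Q\<^sub>S K] assms(4,5,8) by simp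
  qed
qed

end
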